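(* For every positive integer $n$ there exists a constant $c_n$ with $|c_n|\le 1$ such that $\gamma_{Lg}(P_n)=\frac{2n}{3}+c_n$.
   Context: $P_n$ denotes the path graph on $n$ vertices. For a vertex $v$ of a graph $G$, $N(v)$ is its open neighborhood and $N[v]=N(v)\cup\{v\}$ its closed neighborhood. In the L-domination game on a finite graph $G$ two players, Dominator and Staller, alternately select a vertex of $G$, with Dominator moving first. In the $i$-th move, after the moves $v_1,\dots,v_{i-1}$, the choice of a vertex $v_i$ is legal if $N[v_i]\setminus\bigcup_{j=1}^{i-1}N(v_j)\neq\emptyset$ and $v_i\neq v_j$ for all $j<i$. The game ends when no legal move is available; its length is the total number of moves played. Dominator wants to minimize the length, Staller wants to maximize it. The number $\gamma_{Lg}(G)$ is the length of the game under optimal play by both players. *)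

theory Defs
  imports Complex_Main "Graph_Theory.Pair_Digraph"
begin

text \<open>
  Finite simple graphs are rendered by the \<^locale>\<open>pair_graph\<close> structures of the
  Graph Theory library: an edge between \<open>u\<close> and \<open>v\<close> is the pair of arcs \<open>(u, v)\<close>, \<open>(v, u)\<close>.
\<close>

definition path_graph :: "nat \<Rightarrow> nat pair_pre_digraph" where
  "path_graph n =
     \<lparr>pverts = {1..n},
      parcs = {(i, j). i \<in> {1..n} \<and> j \<in> {1..n} \<and> (j = Suc i \<or> i = Suc j)}\<rparr>"

lemma pair_graph_path_graph: "pair_graph (path_graph n)"
proof -
  have "finite (parcs (path_graph n))"
    by (rule finite_subset[of _ "{1..n} \<times> {1..n}"]) (auto simp: path_graph_def)
  then show ?thesis
    by unfold_locales (auto simp: path_graph_def symmetric_def sym_def arcs_ends_def arc_to_ends_def)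
qed

definition open_neighborhood :: "'a pair_pre_digraph \<Rightarrow> 'a \<Rightarrow> 'a set" where
  "open_neighborhood G v = {u. (v, u) \<in> parcs G}"

definition closed_neighborhood :: "'a pair_pre_digraph \<Rightarrow> 'a \<Rightarrow> 'a set" where
  "closed_neighborhood G v = insert v (open_neighborhood G v)"

text \<open>
  Legality of a move depends only on the set \<open>S\<close> of the vertices selected so far, not on the
  order in which they were selected, so \<open>S\<close> represents the history of the game.
\<close>

definition legal_moves :: "'a pair_pre_digraph \<Rightarrow> 'a set \<Rightarrow> 'a set" where
  "legal_moves G S =
     {v \<in> pverts G. v \<notin> S \<and> closed_neighborhood G v - (\<Union>u\<in>S. open_neighborhood G u) \<noteq> {}}"

datatype player = Dominator | Staller

fun opponent :: "player \<Rightarrow> player" where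
  "opponent Dominator = Staller"
| "opponent Staller = Dominator"

text \<open>
  \<open>remaining_moves G p S\<close> is the number of moves still played, under optimal play by both
  players, when the vertices in \<open>S\<close> have been selected and it is the turn of player \<open>p\<close>.
  The finiteness condition ensures termination and holds for all graphs under consideration.
\<close>

function remaining_moves :: "'a pair_pre_digraph \<Rightarrow> player \<Rightarrow> 'a set \<Rightarrow> nat" where
  "remaining_moves G p S =
     (if finite (pverts G) \<and> legal_moves G S \<noteq> {} then
        Suc (case p of
               Dominator \<Rightarrow> MIN v \<in> legal_moves G S. remaining_moves G (opponent p) (insert v S)
             | Staller \<Rightarrow> MAX v \<in> legal_moves G S. remaining_moves G (opponent p) (insert v S))
      else 0)"
  by pat_completeness auto
termination
proof (relation "measure (\<lambda>(G, p, S). card (pverts G - S))", goal_cases)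
  case 1
  show ?case by simp
next
  case (2 G p S v)
  then have "pverts G - insert v S \<subset> pverts G - S"
    by (auto simp: legal_moves_def)
  with 2 show ?case by (auto intro: psubset_card_mono)
next
  case (3 G p S v)
  then have "pverts G - insert v S \<subset> pverts G - S"
    by (auto simp: legal_moves_def)
  with 3 show ?case by (auto intro: psubset_card_mono)
qed

declare remaining_moves.simps[simp del]

definition L_game_number :: "'a pair_pre_digraph \<Rightarrow> nat" ("\<gamma>\<^sub>L\<^sub>g") where
  "\<gamma>\<^sub>L\<^sub>g G = remaining_moves G Dominator {}"

end

theory Submission
  imports Defs
begin

text \<open>
  A vertex is undominated if no neighbour of it has been selected. Every move dominates at
  most two new vertices, and Staller can keep to one in all but a single move;
  counting gives the lower bound. For the upper bound, Dominator keeps the set of undominated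
  vertices a disjoint union of far apart intervals, in which an end vertex may have been selected
  (its inner neighbour is then missing from the interval). Each such component carries a weight,
  about \<open>4/3\<close> per vertex, such that every pair of moves (Staller, Dominator) decreases the total
  weight \<open>w\<close> by 4, up to rounding; hence at most \<open>(w + 1) div 2\<close> moves remain when it is
  Staller's turn.
\<close>

section \<open>The game on a path\<close>

text \<open>What sets this game apart from total domination is the move on an undominated vertex
  whose neighbours are all dominated: it is legal, dominates nothing and can be made only once.
  Staller wastes time with such moves, so a position has to record which undominated vertices are
  already selected.

  The slope 4/3 means 4 units, that is two moves, for three vertices: one dominated by Staller and
  two by Dominator. The obstacle is a move \<open>v\<close> of Staller deep inside an interval. It
  leaves the selected vertex \<open>v\<close> at distance 2 from the pieces on both sides, so these
  are not far apart and Dominator has to repair the damage at once by a local answer. The two moves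
  then remove four vertices but create an additional component, and which answer is good enough
  depends on the sizes of the pieces modulo 3.

  Rounding leaves room at odd weights: \<open>2 * k - 1\<close> and \<open>2 * k\<close> give the
  same bound on the number of moves, so from an odd total a drop by 3 is as good as a drop by
  4.\<close>

definition undominated :: "nat \<Rightarrow> nat set \<Rightarrow> int set" where
  "undominated n S = {x \<in> {1..int n}. x - 1 \<notin> int ` S \<and> x + 1 \<notin> int ` S}"

lemma undominated_subset: "undominated n S \<subseteq> {1..int n}"
  by (auto simp: undominated_def)

lemma undominated_empty: "undominated n {} = {1..int n}"
  by (auto simp: undominated_def)

lemma undominated_insert:
  "undominated n (insert v S) = undominated n S - {int v - 1, int v + 1}"
  by (auto simp: undominated_def)

lemma open_neighborhood_path_graph:
  "v \<in> {1..n} \<Longrightarrow> u \<in> open_neighborhood (path_graph n) v \<longleftrightarrow> u \<in> {1..n} \<and> (int u = int v + 1 \<or> int u = int v - 1)"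
  by (auto simp: open_neighborhood_def path_graph_def)

lemma legal_moves_path_graph:
  assumes "S \<subseteq> {1..n}"
  shows "v \<in> legal_moves (path_graph n) S \<longleftrightarrow> v \<in> {1..n} \<and> v \<notin> S \<and>
    {int v - 1, int v, int v + 1} \<inter> undominated n S \<noteq> {}"
proof -
  have und: "int u \<in> undominated n S \<longleftrightarrow> u \<notin> (\<Union>w\<in>S. open_neighborhood (path_graph n) w)"
    if "u \<in> {1..n}" for u
  proof -
    have "u \<in> open_neighborhood (path_graph n) w \<longleftrightarrow> int u - 1 = int w \<or> int u + 1 = int w" if "w \<in> S" for w
      using open_neighborhood_path_graph[of w n u] assms \<open>u \<in> {1..n}\<close> that by auto
    then show ?thesis
      using that by (auto simp: undominated_def image_iff)
  qed
  show ?thesis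
  proof (cases "v \<in> {1..n}")
    case True
    then have "closed_neighborhood (path_graph n) v = {u \<in> {1..n}. int u \<in> {int v - 1, int v, int v + 1}}"
      using open_neighborhood_path_graph[OF True] by (auto simp: closed_neighborhood_def)
    then have "closed_neighborhood (path_graph n) v - (\<Union>w\<in>S. open_neighborhood (path_graph n) w)
      = {u \<in> {1..n}. int u \<in> {int v - 1, int v, int v + 1} \<inter> undominated n S}"
      using und by (simp add: set_eq_iff) blast
    moreover have "{u \<in> {1..n}. int u \<in> {int v - 1, int v, int v + 1} \<inter> undominated n S} = {}
      \<longleftrightarrow> {int v - 1, int v, int v + 1} \<inter> undominated n S = {}" (is "?A = {} \<longleftrightarrow> ?B = {}")
    proof
      assume "?A = {}"
      moreover have "nat x \<in> ?A" if "x \<in> ?B" for x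
        using that by (auto simp: undominated_def)
      ultimately show "?B = {}" by blast
    qed blast
    moreover have "v \<in> pverts (path_graph n)"
      using True by (simp add: path_graph_def)
    ultimately show ?thesis
      unfolding legal_moves_def mem_Collect_eq using True by metis
  qed (auto simp: legal_moves_def path_graph_def)
qed

lemma legal_moves_path_graph_subset: "legal_moves (path_graph n) S \<subseteq> {1..n} - S"
  by (auto simp: legal_moves_def path_graph_def)

text \<open>A selected vertex has no undominated neighbour, so a move that dominates something new
  can never be a repetition.\<close>

lemma legal_moves_path_graph_dominating:
  assumes "S \<subseteq> {1..n}" "v \<in> {1..int n}" "v - 1 \<in> undominated n S \<or> v + 1 \<in> undominated n S"
  shows "nat v \<in> legal_moves (path_graph n) S"
proof -
  have "nat v \<notin> S"
  proof
    assume "nat v \<in> S"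
    with assms(2) have "v \<in> int ` S"
      by (intro image_eqI[of _ _ "nat v"]) auto
    with assms(3) show False
      by (auto simp: undominated_def)
  qed
  with assms show ?thesis
    by (auto simp: legal_moves_path_graph)
qed

text \<open>With two or more vertices every undominated vertex has a neighbour, and that neighbour
  is a legal move. On a single vertex this fails: once selected, it stays undominated although the
  game is over.\<close>

lemma legal_moves_path_graph_empty_iff:
  assumes "S \<subseteq> {1..n}" "n \<ge> 2"
  shows "legal_moves (path_graph n) S = {} \<longleftrightarrow> undominated n S = {}"
proof
  assume "undominated n S = {}"
  then show "legal_moves (path_graph n) S = {}"
    using legal_moves_path_graph[OF assms(1)] by auto
next
  assume empty: "legal_moves (path_graph n) S = {}"
  show "undominated n S = {}"
  proof (rule ccontr)
    assume "undominated n S \<noteq> {}"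
    then obtain x where x: "x \<in> undominated n S" by auto
    then have "x \<in> {1..int n}" by (auto simp: undominated_def)
    then have "x - 1 \<in> {1..int n} \<or> x + 1 \<in> {1..int n}" using assms(2) by auto
    then show False
      using x empty legal_moves_path_graph_dominating[OF assms(1), of "x - 1"]
        legal_moves_path_graph_dominating[OF assms(1), of "x + 1"] by auto
  qed
qed

section \<open>One-step estimates for the value of the game\<close>

lemma remaining_moves_eq_0: "legal_moves G S = {} \<Longrightarrow> remaining_moves G p S = 0"
  by (subst remaining_moves.simps) simp

context
  fixes G :: "'a pair_pre_digraph" and S :: "'a set"
  assumes finite_verts: "finite (pverts G)"
begin

lemma finite_legal_moves: "finite (legal_moves G S)"
  using finite_verts by (auto simp: legal_moves_def)

lemma remaining_moves_Dominator_le: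
  assumes "v \<in> legal_moves G S" "remaining_moves G Staller (insert v S) \<le> m"
  shows "remaining_moves G Dominator S \<le> Suc m"
proof -
  have "(MIN v \<in> legal_moves G S. remaining_moves G Staller (insert v S)) \<le> m"
    using assms finite_legal_moves by (intro order_trans[OF Min_le assms(2)]) auto
  then show ?thesis
    using assms(1) by (subst remaining_moves.simps) auto
qed

lemma remaining_moves_Staller_le:
  assumes "\<And>v. v \<in> legal_moves G S \<Longrightarrow> remaining_moves G Dominator (insert v S) \<le> m"
  shows "remaining_moves G Staller S \<le> Suc m"
proof (cases "legal_moves G S = {}")
  case False
  then have "(MAX v \<in> legal_moves G S. remaining_moves G Dominator (insert v S)) \<le> m"
    using assms finite_legal_moves by auto
  then show ?thesis
    using False by (subst remaining_moves.simps) auto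
qed (simp add: remaining_moves_eq_0)

lemma remaining_moves_Staller_ge:
  assumes "v \<in> legal_moves G S" "m \<le> remaining_moves G Dominator (insert v S)"
  shows "Suc m \<le> remaining_moves G Staller S"
proof -
  have "m \<le> (MAX v \<in> legal_moves G S. remaining_moves G Dominator (insert v S))"
    using assms finite_legal_moves by (intro order_trans[OF assms(2) Max_ge]) auto
  then show ?thesis
    using assms(1) finite_verts by (subst remaining_moves.simps) auto
qed

lemma remaining_moves_Dominator_ge:
  assumes "legal_moves G S \<noteq> {}"
    and "\<And>v. v \<in> legal_moves G S \<Longrightarrow> m \<le> remaining_moves G Staller (insert v S)"
  shows "Suc m \<le> remaining_moves G Dominator S"
proof -
  have "m \<le> (MIN v \<in> legal_moves G S. remaining_moves G Staller (insert v S))"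
    using assms finite_legal_moves by auto
  then show ?thesis
    using assms(1) finite_verts by (subst remaining_moves.simps) auto
qed

end

lemma finite_pverts_path_graph: "finite (pverts (path_graph n))"
  by (simp add: path_graph_def)

section \<open>The lower bound\<close>

text \<open>
  If the least undominated vertex is not \<open>1\<close>, its left neighbour dominates nothing else, and
  similarly at the right end. So only when both ends of the path are undominated may Staller
  be forced to dominate two vertices; the move \<open>2\<close> ends this state for good.
\<close>

definition both_ends :: "nat \<Rightarrow> int set \<Rightarrow> nat" where
  "both_ends n U = (if 1 \<in> U \<and> int n \<in> U then 1 else 0)"

lemma exists_slow_move:
  assumes U: "U \<subseteq> {1..int n}" "U \<noteq> {}" and n: "n \<ge> 2"
  shows "\<exists>v\<in>{1..int n}. (v - 1 \<in> U \<or> v + 1 \<in> U) \<and>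
    card U + both_ends n (U - {v - 1, v + 1}) \<le> Suc (card (U - {v - 1, v + 1}) + both_ends n U)"
proof -
  have fin: "finite U" using U(1) by (rule finite_subset) simp
  have mono: "both_ends n (U - X) \<le> both_ends n U" for X
    by (auto simp: both_ends_def)
  have one: ?thesis if "v \<in> {1..int n}" "v - 1 \<in> U \<and> v + 1 \<notin> U \<or> v + 1 \<in> U \<and> v - 1 \<notin> U" for v
  proof -
    define x where "x = (if v - 1 \<in> U then v - 1 else v + 1)"
    have "x \<in> U" "U - {v - 1, v + 1} = U - {x}" using that by (auto simp: x_def)
    then have "card U = Suc (card (U - {v - 1, v + 1}))"
      using card_Suc_Diff1[OF fin, of x] by simp
    then show ?thesis using that mono[of "{v - 1, v + 1}"] by (intro bexI[of _ v]) auto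
  qed
  have mem: "Min U \<in> U" "Max U \<in> U" using fin U by auto
  have min: "x \<notin> U" if "x < Min U" for x using fin that by (meson Min_le leD)
  have max: "x \<notin> U" if "x > Max U" for x using fin that by (meson Max_ge leD)
  consider "Min U \<ge> 2" | "Max U < int n" | "1 \<in> U" "int n \<in> U"
  proof -
    have "1 \<le> Min U" "Max U \<le> int n" using mem U(1) by auto
    then have "Min U \<ge> 2 \<or> Max U < int n \<or> Min U = 1 \<and> Max U = int n" by linarith
    then show thesis using that mem by metis
  qed
  then show ?thesis
  proof cases
    case 1
    show ?thesis
    proof (rule one)
      show "Min U - 1 \<in> {1..int n}" using 1 mem U by force
      show "Min U - 1 - 1 \<in> U \<and> Min U - 1 + 1 \<notin> U \<or> Min U - 1 + 1 \<in> U \<and> Min U - 1 - 1 \<notin> U"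
        using mem min[of "Min U - 1 - 1"] by simp
    qed
  next
    case 2
    show ?thesis
    proof (rule one)
      show "Max U + 1 \<in> {1..int n}" using 2 mem U by force
      show "Max U + 1 - 1 \<in> U \<and> Max U + 1 + 1 \<notin> U \<or> Max U + 1 + 1 \<in> U \<and> Max U + 1 - 1 \<notin> U"
        using mem max[of "Max U + 1 + 1"] by simp
    qed
  next
    case 3
    \<comment> \<open>The second vertex that the move \<open>2\<close> may dominate is paid for by
      \<open>both_ends\<close> falling from 1 to 0.\<close>
    have "card U - card {1, 3::int} \<le> card (U - {1, 3})"
      by (rule diff_card_le_card_Diff) simp
    then show ?thesis using 3 n by (intro bexI[of _ 2]) (auto simp: both_ends_def)
  qed
qed

text \<open>A potential argument. A move of Dominator lowers the left side by at most 4, paid by 3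
  for the move and 1 for passing the turn. A slow move of Staller lowers it by 2, which is 3 minus
  the 1 that comes back with the turn.\<close>

lemma lower_bound:
  assumes "n \<ge> 2" "S \<subseteq> {1..n}"
  shows "2 * card (undominated n S) \<le> 3 * remaining_moves (path_graph n) p S
    + 2 * both_ends n (undominated n S) + (case p of Dominator \<Rightarrow> 1 | Staller \<Rightarrow> 0)"
  using assms(2)
proof (induction "card ({1..n} - S)" arbitrary: S p rule: less_induct)
  case less
  let ?U = "undominated n S" and ?G = "path_graph n"
  show ?case
  proof (cases "?U = {}")
    case False
    then have legal: "legal_moves ?G S \<noteq> {}"
      using legal_moves_path_graph_empty_iff less.prems assms by blast
    have IH: "2 * card (undominated n (insert v S)) \<le> 3 * remaining_moves ?G q (insert v S)
        + 2 * both_ends n (undominated n (insert v S)) + (case q of Dominator \<Rightarrow> 1 | Staller \<Rightarrow> 0)"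
      if v: "v \<in> legal_moves ?G S" for q v
    proof (rule less.hyps)
      have "v \<in> {1..n} - S" using v legal_moves_path_graph_subset by blast
      then show "card ({1..n} - insert v S) < card ({1..n} - S)" "insert v S \<subseteq> {1..n}"
        using less.prems by (auto simp del: card_Diff_insert intro!: psubset_card_mono)
    qed
    show ?thesis
    proof (cases p)
      case Dominator
      \<comment> \<open>The induction hypothesis solved for the number of moves, since
        \<open>(k + 2) div 3\<close> is the ceiling of \<open>k / 3\<close>. The bound mentions only
        \<open>?U\<close>, so that it is the same for all moves of Dominator.\<close>
      have "(2 * card ?U - 2 * both_ends n ?U - 4 + 2) div 3 \<le> remaining_moves ?G Staller (insert v S)"
        if v: "v \<in> legal_moves ?G S" for v
      proof -
        have "card ?U - card {int v - 1, int v + 1} \<le> card (undominated n (insert v S))"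
          unfolding undominated_insert by (rule diff_card_le_card_Diff) simp
        moreover have "card {int v - 1, int v + 1} = 2" by simp
        moreover have "both_ends n (undominated n (insert v S)) \<le> both_ends n ?U"
          by (auto simp: both_ends_def undominated_insert)
        ultimately show ?thesis using IH[OF v, of Staller] by simp
      qed
      then have "Suc ((2 * card ?U - 2 * both_ends n ?U - 4 + 2) div 3) \<le> remaining_moves ?G p S"
        unfolding Dominator
        by (intro remaining_moves_Dominator_ge finite_pverts_path_graph legal)
      then show ?thesis using Dominator by simp
    next
      case Staller
      obtain v where v: "v \<in> {1..int n}" "v - 1 \<in> ?U \<or> v + 1 \<in> ?U"
        and card: "card ?U + both_ends n (?U - {v - 1, v + 1})
          \<le> Suc (card (?U - {v - 1, v + 1}) + both_ends n ?U)"
        using exists_slow_move[OF undominated_subset False assms(1)] by blast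
      have *: "nat v \<in> legal_moves ?G S"
        using v less.prems by (intro legal_moves_path_graph_dominating)
      then have "Suc (remaining_moves ?G Dominator (insert (nat v) S)) \<le> remaining_moves ?G p S"
        unfolding Staller by (intro remaining_moves_Staller_ge[OF finite_pverts_path_graph]) auto
      moreover have "undominated n (insert (nat v) S) = ?U - {v - 1, v + 1}"
        using v(1) by (simp add: undominated_insert)
      ultimately show ?thesis using IH[OF *, of Dominator] card Staller by simp
    qed
  qed simp
qed

section \<open>Components and their weights\<close>

text \<open>
  Twice the number of moves in an isolated component, made additive: \<open>weight\<close> takes the values
  \<open>4q + 2\<close>, \<open>4q + 3\<close>, \<open>4q + 4\<close> at \<open>3q\<close>, \<open>3q + 1\<close>, \<open>3q + 2\<close>. The exceptional values at \<open>3\<close> and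
  at a single selected vertex are what makes Dominator's replies in small components work.
\<close>

definition weight :: "int \<Rightarrow> int" where
  "weight u = 4 * (u div 3) + 2 + u mod 3"

definition free_weight :: "int \<Rightarrow> int" where
  "free_weight u = (if u \<le> 0 then 0 else if u = 3 then 5 else weight u)"

definition end_weight :: "int \<Rightarrow> int" where
  "end_weight u = (if u = 1 then 2 else weight u)"

text \<open>
  In \<open>component C Q w\<close>, the set \<open>C\<close> consists of undominated vertices and \<open>Q\<close> of the selected ones
  among them. A selected vertex has no undominated neighbour, so only isolated points of \<open>C\<close>
  can belong to \<open>Q\<close>.
\<close>

inductive component :: "int set \<Rightarrow> int set \<Rightarrow> int \<Rightarrow> bool" where
  free: "a \<le> b \<Longrightarrow> component {a..b} {} (free_weight (b - a + 1))"
| single: "component {a} {a} 2"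
| left: "a \<le> b \<Longrightarrow> component (insert (a - 2) {a..b}) {a - 2} (weight (b - a + 2))"
| right: "a \<le> b \<Longrightarrow> component (insert (b + 2) {a..b}) {b + 2} (weight (b - a + 2))"
| both: "a \<le> b \<Longrightarrow> component (insert (a - 2) (insert (b + 2) {a..b})) {a - 2, b + 2} (weight (b - a + 3))"

text \<open>A move \<open>v\<close> concerns only \<open>v - 1\<close>, \<open>v\<close> and
  \<open>v + 1\<close>, hence at most one of several sets at distance 3. The selected end of a
  component has distance 2 from its interval, so one move can hit both and they must be kept
  together.\<close>

definition separated :: "int set \<Rightarrow> int set \<Rightarrow> bool" where
  "separated A B \<longleftrightarrow> (\<forall>x\<in>A. \<forall>y\<in>B. \<bar>x - y\<bar> \<ge> 3)"

inductive position :: "int set \<Rightarrow> int set \<Rightarrow> int \<Rightarrow> bool" where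
  empty: "position {} {} 0"
| add: "component C Q w \<Longrightarrow> position U P w' \<Longrightarrow> separated C U \<Longrightarrow> position (C \<union> U) (Q \<union> P) (w + w')"

lemma component_weight_ge: "component C Q w \<Longrightarrow> w \<ge> 2"
  by (induction rule: component.induct) (auto simp: free_weight_def weight_def)

lemma component_played_subset: "component C Q w \<Longrightarrow> Q \<subseteq> C"
  by (induction rule: component.induct) auto

lemma position_weight_ge: "position U P w \<Longrightarrow> w \<ge> 0"
  by (induction rule: position.induct) (auto dest: component_weight_ge)

lemma position_played_subset: "position U P w \<Longrightarrow> P \<subseteq> U"
  by (induction rule: position.induct) (auto dest: component_played_subset)

lemma position_weight_eq_0: "position U P 0 \<Longrightarrow> U = {} \<and> P = {}"
  by (erule position.cases) (use component_weight_ge position_weight_ge in fastforce)+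

lemma separated_commute: "separated A B \<Longrightarrow> separated B A"
  unfolding separated_def by (metis abs_minus_commute)

lemma separated_Un [simp]:
  "separated (A \<union> B) C \<longleftrightarrow> separated A C \<and> separated B C"
  "separated A (B \<union> C) \<longleftrightarrow> separated A B \<and> separated A C"
  by (auto simp: separated_def)

lemma separated_mono: "separated A B \<Longrightarrow> A' \<subseteq> A \<Longrightarrow> B' \<subseteq> B \<Longrightarrow> separated A' B'"
  by (auto simp: separated_def)

lemma position_Un:
  "position U P w \<Longrightarrow> position V Q w' \<Longrightarrow> separated U V \<Longrightarrow> position (U \<union> V) (P \<union> Q) (w + w')"
proof (induction rule: position.induct)
  case (add C R w1 U P w2)
  then show ?case
    using position.add[OF add.hyps(1), of "U \<union> V" "P \<union> Q" "w2 + w'"]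
    by (simp add: Un_assoc add.assoc)
qed simp

lemma position_component: "component C Q w \<Longrightarrow> position C Q w"
  using position.add[OF _ position.empty, of C Q w] by (simp add: separated_def)

text \<open>Brings the component hit by Staller's move to the front, whatever the order in which the
  position was built.\<close>

lemma position_decompose:
  assumes "position U P w" "x \<in> U"
  shows "\<exists>C Q v V R v'. component C Q v \<and> position V R v' \<and> separated C V \<and> x \<in> C \<and>
    U = C \<union> V \<and> P = Q \<union> R \<and> w = v + v'"
  using assms
proof (induction rule: position.induct)
  case (add C Q w U P w')
  show ?case
  proof (cases "x \<in> C")
    case True
    with add show ?thesis by blast
  next
    case False
    with add obtain D S v V R v' where *: "component D S v" "position V R v'" "separated D V" "x \<in> D"
      "U = D \<union> V" "P = S \<union> R" "w' = v + v'"
      by blast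
    have "position (C \<union> V) (Q \<union> R) (w + v')"
      using * add by (intro position.add) auto
    moreover have "separated D (C \<union> V)"
      using * add.hyps(3) by (auto dest: separated_commute)
    moreover have "C \<union> U = D \<union> (C \<union> V)" "Q \<union> P = S \<union> (Q \<union> R)" "w + w' = v + (w + v')"
      using * by auto
    ultimately show ?thesis using *(1,4) by blast
  qed
qed simp

text \<open>A sum of even weights is even. The odd component is where Dominator can gain 3 instead
  of 2.\<close>

lemma position_odd_component:
  assumes "position U P w" "odd w"
  shows "\<exists>C Q v V R v'. component C Q v \<and> position V R v' \<and> separated C V \<and> odd v \<and>
    U = C \<union> V \<and> P = Q \<union> R \<and> w = v + v'"
  using assms
proof (induction rule: position.induct)
  case (add C Q w U P w')
  show ?case
  proof (cases "odd w")
    case True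
    with add show ?thesis by blast
  next
    case False
    with add obtain D S v V R v' where *: "component D S v" "position V R v'" "separated D V" "odd v"
      "U = D \<union> V" "P = S \<union> R" "w' = v + v'"
      by auto
    have "position (C \<union> V) (Q \<union> R) (w + v')"
      using * add by (intro position.add) auto
    moreover have "separated D (C \<union> V)"
      using * add.hyps(3) by (auto dest: separated_commute)
    moreover have "C \<union> U = D \<union> (C \<union> V)" "Q \<union> P = S \<union> (Q \<union> R)" "w + w' = v + (w + v')"
      using * by auto
    ultimately show ?thesis using *(1,4) by blast
  qed
qed simp

text \<open>Reflecting the path is negation of integers; this halves the case analysis of Staller's
  moves.\<close>

lemma component_uminus: "component C Q w \<Longrightarrow> component (uminus ` C) (uminus ` Q) w"
proof (induction rule: component.induct)
  case (free a b)
  then show ?case using component.free[of "- b" "- a"] by simp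
next
  case (single a)
  then show ?case using component.single by simp
next
  case (left a b)
  then show ?case using component.right[of "- b" "- a"] by simp
next
  case (right a b)
  then show ?case using component.left[of "- b" "- a"] by simp
next
  case (both a b)
  then show ?case using component.both[of "- b" "- a"] by (simp add: insert_commute)
qed

lemma position_uminus: "position U P w \<Longrightarrow> position (uminus ` U) (uminus ` P) w"
proof (induction rule: position.induct)
  case (add C Q w U P w')
  have "separated (uminus ` C) (uminus ` U)"
    using add.hyps(3) unfolding separated_def by (simp add: abs_minus_commute)
  then show ?case
    using position.add[OF component_uminus[OF add.hyps(1)] add.IH] by (simp add: image_Un)
qed (use position.empty in simp)

text \<open>Empty intervals are covered because \<open>free_weight\<close> vanishes at all
  nonpositive arguments, so answers close to an end need no case of their own.\<close>

lemma position_free: "position {a..b} {} (free_weight (b - a + 1))"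
proof (cases "a \<le> b")
  case True
  then show ?thesis by (intro position_component component.free)
next
  case False
  then show ?thesis using position.empty by (simp add: free_weight_def)
qed

lemma position_single: "position {a} {a} 2"
  by (intro position_component component.single)

text \<open>For \<open>a = b + 1\<close> only the selected vertex is left; the value of
  \<open>end_weight\<close> at 1 is the weight of that component.\<close>

lemma position_left:
  assumes "a \<le> b + 1"
  shows "position (insert (a - 2) {a..b}) {a - 2} (end_weight (b - a + 2))"
proof (cases "a \<le> b")
  case True
  then show ?thesis using position_component[OF component.left[OF True]] by (simp add: end_weight_def)
next
  case False
  then have "b = a - 1" using assms by simp
  then show ?thesis using position_single by (simp add: end_weight_def)
qed

lemma position_right:
  assumes "a \<le> b + 1"
  shows "position (insert (b + 2) {a..b}) {b + 2} (end_weight (b - a + 2))"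
proof (cases "a \<le> b")
  case True
  then show ?thesis using position_component[OF component.right[OF True]] by (simp add: end_weight_def)
next
  case False
  then have "b = a - 1" using assms by simp
  then show ?thesis using position_single by (simp add: end_weight_def)
qed

lemma position_both:
  assumes "a \<le> b + 1"
  shows "position (insert (a - 2) (insert (b + 2) {a..b})) {a - 2, b + 2} (weight (b - a + 3))"
proof (cases "a \<le> b")
  case True
  then show ?thesis by (intro position_component component.both)
next
  case False
  then have "b = a - 1" using assms by simp
  \<comment> \<open>Two selected vertices at distance 3 form two components, and
    \<open>weight 2 = 2 + 2\<close>.\<close>
  then show ?thesis
    using position_Un[OF position_single[of "a - 2"] position_single[of "a + 1"]]
    by (simp add: separated_def weight_def insert_commute add.commute)
qed

definition gain_move :: "int set \<Rightarrow> int \<Rightarrow> bool" where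
  "gain_move U v \<longleftrightarrow> v - 1 \<in> U \<or> v + 1 \<in> U"

text \<open>Selected vertices are kept only while undominated: the closed neighbourhood of a
  dominated selected vertex is dominated altogether, so nothing is lost by forgetting it.\<close>

definition reduces :: "int \<Rightarrow> int set \<Rightarrow> int set \<Rightarrow> int \<Rightarrow> bool" where
  "reduces v U P w \<longleftrightarrow> gain_move U v \<and>
     position (U - {v - 1, v + 1}) (insert v P \<inter> (U - {v - 1, v + 1})) w"

lemma reducesI:
  assumes "position U' P' w" "v - 1 \<in> U \<or> v + 1 \<in> U"
    and "U - {v - 1, v + 1} = U'" "insert v P \<inter> U' = P'"
  shows "reduces v U P w"
  using assms by (simp add: reduces_def gain_move_def)

lemma reduces_Un:
  assumes "reduces v U P w" "P \<subseteq> U" "position V Q w'" "separated U V"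
  shows "reduces v (U \<union> V) (P \<union> Q) (w + w')"
proof -
  obtain x where x: "x \<in> U" "\<bar>x - v\<bar> = 1"
    using assms(1) by (auto simp: reduces_def gain_move_def)
  have far: "\<bar>y - v\<bar> \<ge> 2" if "y \<in> V" for y
    using x assms(4) that unfolding separated_def by (smt (verit))
  have "Q \<subseteq> V" using assms(3) by (rule position_played_subset)
  moreover have "U \<inter> V = {}"
    using assms(4) by (force simp: separated_def)
  moreover have "v \<notin> V" "V - {v - 1, v + 1} = V"
    using far[of v] far[of "v - 1"] far[of "v + 1"] by auto
  ultimately have "insert v (P \<union> Q) \<inter> ((U \<union> V) - {v - 1, v + 1}) = insert v P \<inter> (U - {v - 1, v + 1}) \<union> Q"
    and "(U \<union> V) - {v - 1, v + 1} = (U - {v - 1, v + 1}) \<union> V"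
    using assms(2) by auto
  moreover have "position ((U - {v - 1, v + 1}) \<union> V) (insert v P \<inter> (U - {v - 1, v + 1}) \<union> Q) (w + w')"
    using assms by (intro position_Un) (auto simp: reduces_def elim: separated_mono)
  ultimately show ?thesis
    using assms(1) by (simp add: reduces_def gain_move_def) blast
qed

text \<open>The interval \<open>{lo..hi}\<close> is the board, kept general because reflection moves
  it. With at least two vertices it contains a neighbour of \<open>x\<close>, even if
  \<open>x\<close> is an end.\<close>

lemma reduces_singleton:
  assumes "x \<in> {lo..hi}" "lo < hi" "U = {x}"
  shows "\<exists>v\<in>{lo..hi}. reduces v U P 0"
proof -
  have "reduces v {x} P 0" if "\<bar>v - x\<bar> = 1" for v
  proof -
    from that have "{x} - {v - 1, v + 1} = {}" by auto
    with that show ?thesis using position.empty by (auto simp: reduces_def gain_move_def)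
  qed
  from this[of "x + 1"] this[of "x - 1"] assms show ?thesis
    by (cases "x < hi") (force intro: bexI[of _ "x + 1"] bexI[of _ "x - 1"])+
qed

section \<open>Dominator's answers\<close>

text \<open>
  Here \<open>U\<close> and \<open>P\<close> describe a component of former weight \<open>w\<close> after a move of Staller. If the weight
  has dropped by 2, then Dominator may move anywhere, since some move always drops it by another 2.
  If it has dropped only by 1 and \<open>w\<close> is odd, then Dominator either plays in another component of
  odd weight, where a drop by 3 is possible, or the total weight is odd and a drop by 3 in the pair
  of moves suffices because of rounding.
\<close>

definition answerable :: "int \<Rightarrow> int \<Rightarrow> int set \<Rightarrow> int set \<Rightarrow> int \<Rightarrow> bool" where
  "answerable lo hi U P w \<longleftrightarrow> (\<exists>w'. position U P w' \<and> w' + 2 \<le> w) \<or> (odd w \<and> position U P (w - 1)) \<or>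
     (\<exists>v\<in>{lo..hi}. \<exists>w'. reduces v U P w' \<and> w' + 4 \<le> w)"

lemma answerable_position: "position U' P' w' \<Longrightarrow> U = U' \<Longrightarrow> P = P' \<Longrightarrow> w' + 2 \<le> w \<Longrightarrow> answerable lo hi U P w"
  by (auto simp: answerable_def)

lemma answerable_odd: "position U' P' w' \<Longrightarrow> U = U' \<Longrightarrow> P = P' \<Longrightarrow> w' + 1 = w \<Longrightarrow> odd w \<Longrightarrow> answerable lo hi U P w"
  by (auto simp: answerable_def)

lemma answerable_reply: "reduces v U P w' \<Longrightarrow> v \<in> {lo..hi} \<Longrightarrow> w' + 4 \<le> w \<Longrightarrow> answerable lo hi U P w"
  by (auto simp: answerable_def)

lemma answerable_singleton:
  assumes "x \<in> {lo..hi}" "lo < hi" "U = {x}" "w \<ge> 4"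
  shows "answerable lo hi U P w"
  using reduces_singleton[OF assms(1-3), of P] assms(4) unfolding answerable_def by fastforce

lemma uminus_image_Diff_Int:
  fixes U P :: "int set"
  shows "uminus ` (U - {v - 1, v + 1}) = uminus ` U - {- v - 1, - v + 1}"
    and "uminus ` (insert v P \<inter> W) = insert (- v) (uminus ` P) \<inter> uminus ` W"
  by (auto simp: image_iff)

lemma reduces_uminus:
  assumes "reduces v U P w"
  shows "reduces (- v) (uminus ` U) (uminus ` P) w"
proof -
  have "- v + 1 \<in> uminus ` U \<or> - v - 1 \<in> uminus ` U"
    using assms by (force simp: reduces_def gain_move_def)
  moreover have "position (uminus ` (U - {v - 1, v + 1})) (uminus ` (insert v P \<inter> (U - {v - 1, v + 1}))) w"
    using assms by (intro position_uminus) (simp add: reduces_def)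
  ultimately show ?thesis
    unfolding uminus_image_Diff_Int by (auto simp: reduces_def gain_move_def)
qed

lemma answerable_uminus:
  assumes "answerable (- hi) (- lo) (uminus ` U) (uminus ` P) w"
  shows "answerable lo hi U P w"
proof -
  have inv: "uminus ` uminus ` X = X" for X :: "int set" by (simp add: image_image)
  from assms show ?thesis
    unfolding answerable_def
  proof (elim disjE exE bexE conjE)
    fix w' assume "position (uminus ` U) (uminus ` P) w'" "w' + 2 \<le> w"
    then show "(\<exists>w'. position U P w' \<and> w' + 2 \<le> w) \<or> odd w \<and> position U P (w - 1) \<or>
        (\<exists>v\<in>{lo..hi}. \<exists>w'. reduces v U P w' \<and> w' + 4 \<le> w)"
      using position_uminus[of "uminus ` U" "uminus ` P" w'] by (auto simp: inv)
  next
    assume "odd w" "position (uminus ` U) (uminus ` P) (w - 1)"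
    then show "(\<exists>w'. position U P w' \<and> w' + 2 \<le> w) \<or> odd w \<and> position U P (w - 1) \<or>
        (\<exists>v\<in>{lo..hi}. \<exists>w'. reduces v U P w' \<and> w' + 4 \<le> w)"
      using position_uminus[of "uminus ` U" "uminus ` P" "w - 1"] by (auto simp: inv)
  next
    fix v w' assume *: "v \<in> {- hi..- lo}" "reduces v (uminus ` U) (uminus ` P) w'" "w' + 4 \<le> w"
    then have "- v \<in> {lo..hi}" "reduces (- v) U P w'"
      using reduces_uminus[OF *(2)] by (auto simp: inv)
    with *(3) show "(\<exists>w'. position U P w' \<and> w' + 2 \<le> w) \<or> odd w \<and> position U P (w - 1) \<or>
        (\<exists>v\<in>{lo..hi}. \<exists>w'. reduces v U P w' \<and> w' + 4 \<le> w)"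
      by blast
  qed
qed

section \<open>Arithmetic of the weights\<close>

lemma weight_add_3: "weight (u + 3) = weight u + 4"
  by (simp add: weight_def)

text \<open>The increments of \<open>weight\<close> are 1, 1, 2 periodically. Odd values occur at
  residue 1 modulo 3, and the two increments leading there are 2 and 1.\<close>

lemma weight_add_2:
  "weight u + 2 \<le> weight (u + 2)" (is ?ge)
  "odd (weight (u + 2)) \<Longrightarrow> weight u + 3 \<le> weight (u + 2)" (is "?odd \<Longrightarrow> ?ge'")
proof -
  define q where "q = u div 3"
  have "u = 3 * q + u mod 3" by (simp add: q_def)
  moreover have "u mod 3 = 0 \<or> u mod 3 = 1 \<or> u mod 3 = 2" by presburger
  ultimately consider "u = 3 * q" | "u = 3 * q + 1" | "u = 3 * q + 2" by fastforce
  then have "?ge \<and> (?odd \<longrightarrow> ?ge')"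
  proof cases
    case 1
    then have "u div 3 = q" "u mod 3 = 0" "(u + 2) div 3 = q" "(u + 2) mod 3 = 2" by presburger+
    then show ?thesis by (simp add: weight_def)
  next
    case 2
    then have "u div 3 = q" "u mod 3 = 1" "(u + 2) div 3 = q + 1" "(u + 2) mod 3 = 0" by presburger+
    then show ?thesis by (simp add: weight_def)
  next
    case 3
    then have "u div 3 = q" "u mod 3 = 2" "(u + 2) div 3 = q + 1" "(u + 2) mod 3 = 1" by presburger+
    then show ?thesis by (simp add: weight_def)
  qed
  then show ?ge "?odd \<Longrightarrow> ?ge'" by blast+
qed

lemma weight_mono: "u \<le> v \<Longrightarrow> weight u \<le> weight v"
  unfolding weight_def by presburger

text \<open>The formula for \<open>weight\<close> gives 0 at -1 but a negative value at -2, hence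
  the bound on \<open>u\<close>.\<close>

lemma free_weight_le: "u \<ge> -1 \<Longrightarrow> free_weight u \<le> weight u"
  unfolding free_weight_def weight_def by presburger

lemma end_weight_le: "end_weight u \<le> weight u"
  by (auto simp: end_weight_def weight_def)

text \<open>Let \<open>r\<close> and \<open>r'\<close> be the residues of \<open>x\<close> and
  \<open>y\<close>. If \<open>r + r'\<close> is at least 2, both sides agree; otherwise the
  inequality fails by 1. The second assumption expresses \<open>r + r' \<ge> 2\<close> through
  \<open>u\<close> and \<open>x\<close>.\<close>

lemma weight_split:
  assumes "x + y + 4 = u"
    and "u mod 3 = 0 \<or> u mod 3 = 1 \<and> x mod 3 \<noteq> 0 \<or> u mod 3 = 2 \<and> x mod 3 = 2"
  shows "weight x + weight y + 4 \<le> weight u"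
proof -
  have weight: "weight (3 * q + r) = 4 * q + 2 + r" if "r \<in> {0, 1, 2}" for q r
    using that by (auto simp: weight_def)
  have mod: "z mod 3 \<in> {0, 1, 2}" for z :: int
    using pos_mod_bound[of 3 z] pos_mod_sign[of 3 z] by (simp del: pos_mod_bound pos_mod_sign) linarith
  define q r q' r' where "q = x div 3" "r = x mod 3" "q' = y div 3" "r' = y mod 3"
  then have xy: "x = 3 * q + r" "y = 3 * q' + r'" and r: "r \<in> {0, 1, 2}" "r' \<in> {0, 1, 2}"
    using mod by simp_all
  \<comment> \<open>The first form has a proper remainder if \<open>r + r'\<close> is at least 2,
    the second one if it is at most 1.\<close>
  have "u = 3 * (q + q' + 2) + (r + r' - 2)" "u = 3 * (q + q' + 1) + (r + r' + 1)"
    using assms(1) xy by simp_all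
  then show ?thesis
    using assms(2) r weight[OF r(1), of q] weight[OF r(2), of q']
      weight[of "r + r' - 2" "q + q' + 2"] weight[of "r + r' + 1" "q + q' + 1"] unfolding xy
    by auto presburger+
qed

text \<open>
  When Staller plays in the middle of a component, the answers at distance 1 to the left, 1 to the
  right and 3 to the right leave two components of total size \<open>u - 4\<close>, whose sizes are \<open>(x, y)\<close>,
  \<open>(x + 1, y - 1)\<close> and \<open>(x + 2, y - 2)\<close>; one of these is always good enough.
\<close>

lemma weight_split_cases:
  assumes "x + y + 4 = u"
  obtains "weight x + weight y + 4 \<le> weight u"
  | "weight (x + 1) + weight (y - 1) + 4 \<le> weight u"
  | "x mod 3 = 0" "y mod 3 = 1" "weight (x + 2) + weight (y - 2) + 4 \<le> weight u"
proof -
  have "(u mod 3 = 0 \<or> u mod 3 = 1 \<and> x mod 3 \<noteq> 0 \<or> u mod 3 = 2 \<and> x mod 3 = 2) \<or>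
      (u mod 3 = 1 \<and> (x + 1) mod 3 \<noteq> 0 \<or> u mod 3 = 2 \<and> (x + 1) mod 3 = 2) \<or>
      u mod 3 = 2 \<and> x mod 3 = 0"
    by presburger
  then consider "u mod 3 = 0 \<or> u mod 3 = 1 \<and> x mod 3 \<noteq> 0 \<or> u mod 3 = 2 \<and> x mod 3 = 2"
    | "u mod 3 = 1 \<and> (x + 1) mod 3 \<noteq> 0 \<or> u mod 3 = 2 \<and> (x + 1) mod 3 = 2"
    | "u mod 3 = 2" "x mod 3 = 0"
    by argo
  then show thesis
  proof cases
    case 1
    with weight_split[OF assms] that(1) show thesis by blast
  next
    case 2
    with weight_split[of "x + 1" "y - 1" u] assms that(2) show thesis by simp
  next
    case 3
    moreover from 3 have "(x + 2) mod 3 = 2" "y mod 3 = 1" using assms by presburger+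
    ultimately show thesis using weight_split[of "x + 2" "y - 2" u] assms that(3) by simp
  qed
qed

section \<open>Staller's moves in the different kinds of components\<close>

lemma answerable_free_left:
  assumes "a \<le> b" "a - 1 \<le> v" "v - a \<le> b - v" "{a..b} \<subseteq> {lo..hi}" "lo < hi"
  shows "answerable lo hi ({a..b} - {v - 1, v + 1}) ({v} \<inter> ({a..b} - {v - 1, v + 1})) (free_weight (b - a + 1))"
    (is "answerable lo hi ?U ?P ?w")
proof -
  have range: "lo \<le> a" "b \<le> hi" using assms by auto
  have w: "?w = weight (b - a + 1)" if "b - a \<noteq> 2"
    using that assms(1) by (simp add: free_weight_def)
  have shrink: "weight (b - a + 1) = weight (b - a - 2) + 4"
    using weight_add_3[of "b - a - 2"] by (simp add: algebra_simps)
  consider (outer) "v = a - 1" | (first) "v = a" | (middle) "v = a + 1" "b = a + 2" | (inner) "a + 1 \<le> v" "v + 2 \<le> b"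
    using assms by linarith
  then show ?thesis
  proof cases
    case outer
    then have U: "?U = {a + 1..b}" "?P = {}" by auto
    consider "b = a" | "b = a + 1" | "b = a + 2" | "b \<ge> a + 3" using assms(1) by linarith
    then show ?thesis
    proof cases
      case 1
      then show ?thesis
        unfolding U(2) unfolding U(1)
        by (intro answerable_position[OF position.empty]) (auto simp: free_weight_def weight_def)
    next
      case 2
      then show ?thesis
        unfolding U(2) unfolding U(1) using assms range
        by (intro answerable_singleton[of b]) (auto simp: free_weight_def weight_def)
    next
      \<comment> \<open>The weight drops only from 5 to 4, which is admissible because 5 is
        odd.\<close>
      case 3
      then show ?thesis
        unfolding U(2) unfolding U(1)
        by (intro answerable_odd[OF position_free[of "a + 1" b]]) (auto simp: free_weight_def weight_def)
    next
      case 4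
      have "reduces (a + 2) ?U ?P (end_weight (b - a - 2))"
        unfolding U(2) unfolding U(1) using position_left[of "a + 4" b] 4
        by (intro reducesI[of "insert (a + 2) {a + 4..b}" "{a + 2}"]) (auto simp: algebra_simps)
      then show ?thesis
        using 4 range w shrink end_weight_le[of "b - a - 2"] by (intro answerable_reply) auto
    qed
  next
    case first
    then have U: "?U = insert a {a + 2..b}" "?P = {a}" using assms(1) by auto
    consider "b = a" | "b = a + 1" | "b \<ge> a + 2" using assms(1) by linarith
    then show ?thesis
    proof cases
      \<comment> \<open>The wasted move: Staller selects an isolated vertex and dominates nothing,
        so 3 drops only to 2.\<close>
      case 1
      then show ?thesis
        unfolding U(2) unfolding U(1)
        by (intro answerable_odd[OF position_single[of a]]) (auto simp: free_weight_def weight_def)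
    next
      case 2
      then show ?thesis
        unfolding U(2) unfolding U(1) using assms range
        by (intro answerable_singleton[of a]) (auto simp: free_weight_def weight_def)
    next
      case 3
      have "reduces (a + 1) ?U ?P (free_weight (b - a - 2))"
        unfolding U(2) unfolding U(1) using position_free[of "a + 3" b] 3
        by (intro reducesI[of "{a + 3..b}" "{}"]) (auto simp: algebra_simps)
      moreover have "free_weight (b - a - 2) + 4 \<le> ?w"
        using w shrink free_weight_le[of "b - a - 2"] 3 by (cases "b = a + 2") (auto simp: free_weight_def)
      ultimately show ?thesis
        using 3 range by (intro answerable_reply) auto
    qed
  next
    case middle
    then show ?thesis
      by (intro answerable_position[OF position_single[of v]]) (auto simp: free_weight_def)
  next
    case inner
    have w: "?w = weight (b - a + 1)" using inner w assms(3) by simp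
    have P: "?P = {v}" using inner by auto
    let ?x = "v - 2 - a" and ?y = "b - v - 1"
    have left: "answerable lo hi ?U ?P ?w" if "a + 2 \<le> v" "free_weight ?x + free_weight ?y + 4 \<le> ?w"
    proof (rule answerable_reply[OF _ _ that(2)])
      show "reduces (v - 1) ?U ?P (free_weight ?x + free_weight ?y)"
        unfolding P using inner that(1) position_Un[OF position_free[of a "v - 3"] position_free[of "v + 2" b]]
        by (intro reducesI[of "{a..v - 3} \<union> {v + 2..b}" "{}"]) (auto simp: separated_def algebra_simps)
    qed (use inner range in auto)
    have right: "answerable lo hi ?U ?P ?w" if "free_weight (?x + 1) + free_weight (?y - 1) + 4 \<le> ?w"
    proof (rule answerable_reply[OF _ _ that])
      show "reduces (v + 1) ?U ?P (free_weight (?x + 1) + free_weight (?y - 1))"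
        unfolding P using inner position_Un[OF position_free[of a "v - 2"] position_free[of "v + 3" b]]
        by (intro reducesI[of "{a..v - 2} \<union> {v + 3..b}" "{}"]) (auto simp: separated_def algebra_simps)
    qed (use inner range in auto)
    \<comment> \<open>The answer \<open>v + 3\<close> dominates \<open>v + 2\<close> and
      \<open>v + 4\<close>. It leaves \<open>v\<close> as selected right end of one piece and
      \<open>v + 3\<close> as selected left end of the other, at distance exactly 3.\<close>
    have far: "answerable lo hi ?U ?P ?w" if "a + 2 \<le> v" "v + 4 \<le> b" "end_weight (?x + 2) + end_weight (?y - 2) + 4 \<le> ?w"
    proof (rule answerable_reply[OF _ _ that(3)])
      show "reduces (v + 3) ?U ?P (end_weight (?x + 2) + end_weight (?y - 2))"
        unfolding P using that(1,2) position_Un[OF position_right[of a "v - 2"] position_left[of "v + 5" b]]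
        by (intro reducesI[of "insert v {a..v - 2} \<union> insert (v + 3) {v + 5..b}" "{v + 3, v}"]) (auto simp: separated_def algebra_simps)
    qed (use that inner range in auto)
    consider "v = a + 1" | "v = a + 2" | "?x \<ge> 1" using inner by linarith
    then show ?thesis
    proof cases
      case 1
      then show ?thesis
        using right shrink free_weight_le[of "b - a - 3"] weight_mono[of "b - a - 3" "b - a - 2"] inner
        by (simp add: w free_weight_def algebra_simps)
    next
      case 2
      then show ?thesis
        using left shrink free_weight_le[of "b - a - 3"] weight_mono[of "b - a - 3" "b - a - 2"] inner
        by (simp add: w free_weight_def algebra_simps)
    next
      case 3
      have "?x + ?y + 4 = b - a + 1" by simp
      then show ?thesis
      proof (cases rule: weight_split_cases)
        case 1
        then show ?thesis
          using left free_weight_le[of ?x] free_weight_le[of ?y] 3 inner w by linarith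
      next
        case 2
        then show ?thesis
          using right free_weight_le[of "?x + 1"] free_weight_le[of "?y - 1"] 3 inner w by linarith
      next
        case far': 3
        \<comment> \<open>A positive multiple of 3. As \<open>v\<close> lies in the left half, this
          leaves room for the answer \<open>v + 3\<close>.\<close>
        then have "?x \<ge> 3" using 3 by presburger
        then show ?thesis
          using far far' end_weight_le[of "?x + 2"] end_weight_le[of "?y - 2"] assms(3) w by linarith
      qed
    qed
  qed
qed

text \<open>One selected end breaks the symmetry, so \<open>v\<close> runs through the whole
  component here; reflection then serves components with a selected right end.\<close>

lemma answerable_left:
  assumes "a \<le> b" "a - 3 \<le> v" "v \<le> b + 1" "v \<noteq> a - 2" "insert (a - 2) {a..b} \<subseteq> {lo..hi}" "lo < hi"
  shows "answerable lo hi (insert (a - 2) {a..b} - {v - 1, v + 1})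
    ({v, a - 2} \<inter> (insert (a - 2) {a..b} - {v - 1, v + 1})) (weight (b - a + 2))"
    (is "answerable lo hi ?U ?P ?w")
proof -
  have range: "lo \<le> a - 2" "b \<le> hi" using assms by auto
  have shrink: "?w = weight (b - a - 1) + 4"
    using weight_add_3[of "b - a - 1"] by (simp add: algebra_simps)
  consider (outer) "v = a - 3" | (gap) "v = a - 1" | (first) "v = a" | (second) "v = a + 1"
    | (border) "v = b + 1" "a + 2 \<le> v" | (last) "v = b" "a + 2 \<le> v" | (inner) "a + 2 \<le> v" "v + 1 \<le> b"
    using assms by linarith
  then show ?thesis
  proof cases
    case outer
    then have U: "?U = {a..b}" "?P = {}" by auto
    consider "b = a" | "b = a + 1" | "b \<ge> a + 2" using assms(1) by linarith
    then show ?thesis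
    proof cases
      case 1
      then show ?thesis
        unfolding U(2) unfolding U(1) using assms range
        by (intro answerable_singleton[of b]) (auto simp: weight_def)
    next
      case 2
      have "reduces a ?U ?P 2"
        unfolding U(2) unfolding U(1) using position_single[of a] 2
        by (intro reducesI[of "{a}" "{a}"]) auto
      then show ?thesis
        using 2 range by (intro answerable_reply) (auto simp: weight_def)
    next
      case 3
      have "reduces (a + 1) ?U ?P (end_weight (b - a - 1))"
        unfolding U(2) unfolding U(1) using position_left[of "a + 3" b] 3
        by (intro reducesI[of "insert (a + 1) {a + 3..b}" "{a + 1}"]) (auto simp: algebra_simps)
      then show ?thesis
        using 3 range shrink end_weight_le[of "b - a - 1"] by (intro answerable_reply) auto
    qed
  next
    case gap
    have "free_weight (b - a) + 2 \<le> ?w"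
      using assms(1) weight_add_2[of "b - a"] free_weight_le[of "b - a"] by simp
    with gap show ?thesis
      using position_free[of "a + 1" b]
      by (intro answerable_position[of "{a + 1..b}" "{}"]) (auto simp: algebra_simps)
  next
    case first
    \<comment> \<open>The answer between the selected vertices \<open>a - 2\<close> and
      \<open>a\<close> dominates both of them.\<close>
    have "reduces (a - 1) ?U ?P (free_weight (b - a - 1))"
      using position_free[of "a + 2" b] first
      by (intro reducesI[of "{a + 2..b}" "{}"]) (auto simp: algebra_simps)
    then show ?thesis
      using range assms(1) shrink free_weight_le[of "b - a - 1"] by (intro answerable_reply) auto
  next
    case second
    consider "b = a" | "b = a + 1" | "b \<ge> a + 2" using assms(1) by linarith
    then show ?thesis
    proof cases
      case 1
      with second show ?thesis
        by (intro answerable_position[OF position_single[of "a - 2"]]) (auto simp: weight_def)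
    next
      case 2
      have "reduces (a - 1) ?U ?P 2"
        using position_single[of "a + 1"] 2 second by (intro reducesI[of "{a + 1}" "{a + 1}"]) auto
      then show ?thesis
        using 2 range by (intro answerable_reply) (auto simp: weight_def)
    next
      case 3
      have "reduces (a - 1) ?U ?P (end_weight (b - a - 1))"
        using position_left[of "a + 3" b] 3 second
        by (intro reducesI[of "insert (a + 1) {a + 3..b}" "{a + 1}"]) (auto simp: algebra_simps)
      then show ?thesis
        using 3 range shrink end_weight_le[of "b - a - 1"] by (intro answerable_reply) auto
    qed
  next
    case border
    have "reduces (a - 1) ?U ?P (free_weight (b - a - 1))"
      using position_free[of "a + 1" "b - 1"] border
      by (intro reducesI[of "{a + 1..b - 1}" "{}"]) (auto simp: algebra_simps)
    then show ?thesis
      using range assms(1) shrink free_weight_le[of "b - a - 1"] by (intro answerable_reply) auto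
  next
    case last
    have "reduces (b - 1) ?U ?P (end_weight (b - a - 1))"
      using position_left[of a "b - 3"] last
      by (intro reducesI[of "insert (a - 2) {a..b - 3}" "{a - 2}"]) (auto simp: algebra_simps)
    then show ?thesis
      using last range shrink end_weight_le[of "b - a - 1"] by (intro answerable_reply) auto
  next
    case inner
    have P: "?P = {v, a - 2}" using inner by auto
    let ?x = "v - a - 1" and ?y = "b - v - 1"
    have left: "answerable lo hi ?U ?P ?w" if "end_weight ?x + free_weight ?y + 4 \<le> ?w"
    proof (rule answerable_reply[OF _ _ that])
      show "reduces (v - 1) ?U ?P (end_weight ?x + free_weight ?y)"
        unfolding P using inner position_Un[OF position_left[of a "v - 3"] position_free[of "v + 2" b]]
        by (intro reducesI[of "insert (a - 2) {a..v - 3} \<union> {v + 2..b}" "{a - 2}"]) (auto simp: separated_def algebra_simps)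
    qed (use inner range in auto)
    have right: "answerable lo hi ?U ?P ?w" if "end_weight (?x + 1) + free_weight (?y - 1) + 4 \<le> ?w"
    proof (rule answerable_reply[OF _ _ that])
      show "reduces (v + 1) ?U ?P (end_weight (?x + 1) + free_weight (?y - 1))"
        unfolding P using inner position_Un[OF position_left[of a "v - 2"] position_free[of "v + 3" b]]
        by (intro reducesI[of "insert (a - 2) {a..v - 2} \<union> {v + 3..b}" "{a - 2}"]) (auto simp: separated_def algebra_simps)
    qed (use inner range in auto)
    have far: "answerable lo hi ?U ?P ?w" if "v + 4 \<le> b" "weight (?x + 2) + end_weight (?y - 2) + 4 \<le> ?w"
    proof (rule answerable_reply[OF _ _ that(2)])
      show "reduces (v + 3) ?U ?P (weight (?x + 2) + end_weight (?y - 2))"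
        unfolding P using that(1) inner position_Un[OF position_both[of a "v - 2"] position_left[of "v + 5" b]]
        by (intro reducesI[of "insert (a - 2) (insert v {a..v - 2}) \<union> insert (v + 3) {v + 5..b}" "{a - 2, v} \<union> {v + 3}"])
          (auto simp: separated_def algebra_simps)
    qed (use that inner range in auto)
    have sum: "?x + ?y + 4 = b - a + 2" by simp
    consider "?y = 0" | "?y = 1" | "?y \<ge> 2" using inner by linarith
    then show ?thesis
    proof cases
      case 1
      then show ?thesis
        using left shrink end_weight_le[of ?x] weight_mono[of ?x "b - a - 1"] sum
        by (simp add: free_weight_def)
    next
      case 2
      then show ?thesis
        using right shrink end_weight_le[of "?x + 1"] weight_mono[of "?x + 1" "b - a - 1"] sum
        by (simp add: free_weight_def)
    next
      case 3
      from sum show ?thesis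
      proof (cases rule: weight_split_cases)
        case 1
        then show ?thesis
          using left end_weight_le[of ?x] free_weight_le[of ?y] 3 by linarith
      next
        case 2
        then show ?thesis
          using right end_weight_le[of "?x + 1"] free_weight_le[of "?y - 1"] 3 by linarith
      next
        case far': 3
        \<comment> \<open>At least 2 and of residue 1 modulo 3.\<close>
        then have "?y \<ge> 4" using 3 by presburger
        then show ?thesis
          using far far' end_weight_le[of "?y - 2"] by linarith
      qed
    qed
  qed
qed

lemma answerable_both_left:
  assumes "a \<le> b" "a - 3 \<le> v" "v - a \<le> b - v" "v \<noteq> a - 2"
    and "insert (a - 2) (insert (b + 2) {a..b}) \<subseteq> {lo..hi}" "lo < hi"
  shows "answerable lo hi (insert (a - 2) (insert (b + 2) {a..b}) - {v - 1, v + 1})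
    ({v, a - 2, b + 2} \<inter> (insert (a - 2) (insert (b + 2) {a..b}) - {v - 1, v + 1})) (weight (b - a + 3))"
    (is "answerable lo hi ?U ?P ?w")
proof -
  have range: "lo \<le> a - 2" "b + 2 \<le> hi" using assms by auto
  have shrink: "?w = weight (b - a) + 4"
    using weight_add_3[of "b - a"] by (simp add: algebra_simps)
  consider (outer) "v = a - 3" | (gap) "v = a - 1" | (first) "v = a" | (second) "v = a + 1" | (inner) "a + 2 \<le> v"
    using assms by linarith
  then show ?thesis
  proof cases
    case outer
    \<comment> \<open>Staller has removed the selected end \<open>a - 2\<close>; the answer at the
      opposite end removes \<open>b + 2\<close> together with \<open>b\<close> and leaves a free
      interval.\<close>
    have "reduces (b + 1) ?U ?P (free_weight (b - a))"
      using position_free[of a "b - 1"] outer assms(1)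
      by (intro reducesI[of "{a..b - 1}" "{}"]) (auto simp: algebra_simps)
    then show ?thesis
      using range assms(1) shrink free_weight_le[of "b - a"] by (intro answerable_reply) auto
  next
    case gap
    have "end_weight (b - a + 1) + 2 \<le> ?w"
      using weight_add_2[of "b - a + 1"] end_weight_le[of "b - a + 1"] by (simp add: algebra_simps)
    with gap show ?thesis
      using position_right[of "a + 1" b] assms(1)
      by (intro answerable_position[of "insert (b + 2) {a + 1..b}" "{b + 2}"]) (auto simp: algebra_simps)
  next
    case first
    show ?thesis
    proof (cases "b = a")
      case True
      have "reduces (a - 1) ?U ?P 2"
        using position_single[of "b + 2"] first True by (intro reducesI[of "{b + 2}" "{b + 2}"]) auto
      then show ?thesis
        using range assms(1) True by (intro answerable_reply) (auto simp: weight_def)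
    next
      case False
      have "reduces (a - 1) ?U ?P (end_weight (b - a))"
        using position_right[of "a + 2" b] first False assms(1)
        by (intro reducesI[of "insert (b + 2) {a + 2..b}" "{b + 2}"]) (auto simp: algebra_simps)
      then show ?thesis
        using range assms(1) shrink end_weight_le[of "b - a"] by (intro answerable_reply) auto
    qed
  next
    case second
    have "reduces (a - 1) ?U ?P (weight (b - a))"
      using position_both[of "a + 3" b] second assms(3)
      by (intro reducesI[of "insert (a + 1) (insert (b + 2) {a + 3..b})" "{a + 1, b + 2}"]) (auto simp: algebra_simps)
    then show ?thesis
      using range assms(1) shrink by (intro answerable_reply) auto
  next
    case inner
    have P: "?P = {v, a - 2, b + 2}" using inner assms(3) by auto
    let ?x = "v - a - 1" and ?y = "b - v"
    have left: "answerable lo hi ?U ?P ?w" if "end_weight ?x + end_weight ?y + 4 \<le> ?w"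
    proof (rule answerable_reply[OF _ _ that])
      show "reduces (v - 1) ?U ?P (end_weight ?x + end_weight ?y)"
        unfolding P using inner assms(3) position_Un[OF position_left[of a "v - 3"] position_right[of "v + 2" b]]
        by (intro reducesI[of "insert (a - 2) {a..v - 3} \<union> insert (b + 2) {v + 2..b}" "{a - 2} \<union> {b + 2}"])
          (auto simp: separated_def algebra_simps)
    qed (use inner range assms(3) in auto)
    have right: "answerable lo hi ?U ?P ?w" if "end_weight (?x + 1) + end_weight (?y - 1) + 4 \<le> ?w"
    proof (rule answerable_reply[OF _ _ that])
      show "reduces (v + 1) ?U ?P (end_weight (?x + 1) + end_weight (?y - 1))"
        unfolding P using inner assms(3) position_Un[OF position_left[of a "v - 2"] position_right[of "v + 3" b]]
        by (intro reducesI[of "insert (a - 2) {a..v - 2} \<union> insert (b + 2) {v + 3..b}" "{a - 2} \<union> {b + 2}"])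
          (auto simp: separated_def algebra_simps)
    qed (use inner range assms(3) in auto)
    have far: "answerable lo hi ?U ?P ?w" if "v + 4 \<le> b" "weight (?x + 2) + weight (?y - 2) + 4 \<le> ?w"
    proof (rule answerable_reply[OF _ _ that(2)])
      show "reduces (v + 3) ?U ?P (weight (?x + 2) + weight (?y - 2))"
        unfolding P using that(1) inner position_Un[OF position_both[of a "v - 2"] position_both[of "v + 5" b]]
        by (intro reducesI[of "insert (a - 2) (insert v {a..v - 2}) \<union> insert (v + 3) (insert (b + 2) {v + 5..b})" "{a - 2, v} \<union> {v + 3, b + 2}"])
          (auto simp: separated_def algebra_simps)
    qed (use that inner range in auto)
    have "?x + ?y + 4 = b - a + 3" by simp
    then show ?thesis
    proof (cases rule: weight_split_cases)
      case 1
      then show ?thesis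
        using left end_weight_le[of ?x] end_weight_le[of ?y] by linarith
    next
      case 2
      then show ?thesis
        using right end_weight_le[of "?x + 1"] end_weight_le[of "?y - 1"] by linarith
    next
      case 3
      then have "?x \<ge> 3" using inner by presburger
      then show ?thesis
        using far 3(3) assms(3) by linarith
    qed
  qed
qed

section \<open>The upper bound\<close>

lemma answerable_component:
  assumes "component C Q w" "C \<subseteq> {lo..hi}" "lo < hi" "x \<in> C" "\<bar>x - v\<bar> \<le> 1" "v \<notin> Q"
  shows "answerable lo hi (C - {v - 1, v + 1}) (insert v Q \<inter> (C - {v - 1, v + 1})) w"
  using assms
proof (induction rule: component.induct)
  case (free a b)
  then have bounds: "lo \<le> a" "b \<le> hi" "a - 1 \<le> v" "v \<le> b + 1" by auto
  show ?case
  proof (cases "v - a \<le> b - v")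
    case True
    then show ?thesis using free(1) bounds assms(3) by (intro answerable_free_left) simp_all
  next
    case False
    have "answerable (- hi) (- lo) ({- b..- a} - {- v - 1, - v + 1})
        ({- v} \<inter> ({- b..- a} - {- v - 1, - v + 1})) (free_weight (- a - - b + 1))"
      using free(1) False bounds assms(3) by (intro answerable_free_left) simp_all
    then show ?thesis
      by - (rule answerable_uminus, simp add: uminus_image_Diff_Int)
  qed
next
  case (single a)
  then have "{a} - {v - 1, v + 1} = {}" by auto
  then show ?case by (intro answerable_position[OF position.empty]) auto
next
  case (left a b)
  then have "lo \<le> a - 2" "b \<le> hi" "a - 3 \<le> v" "v \<le> b + 1" "v \<noteq> a - 2" by auto
  then show ?case using left(1) assms(3) by (intro answerable_left) auto
next
  case (right a b)
  then have "lo \<le> a" "b + 2 \<le> hi" "a - 1 \<le> v" "v \<le> b + 3" "v \<noteq> b + 2" by auto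
  then have "answerable (- hi) (- lo) (insert (- b - 2) {- b..- a} - {- v - 1, - v + 1})
      ({- v, - b - 2} \<inter> (insert (- b - 2) {- b..- a} - {- v - 1, - v + 1})) (weight (- a - - b + 2))"
    using right(1) assms(3) by (intro answerable_left) auto
  then show ?case
    by - (rule answerable_uminus, simp add: uminus_image_Diff_Int)
next
  case (both a b)
  then have bounds: "lo \<le> a - 2" "b + 2 \<le> hi" "a - 3 \<le> v" "v \<le> b + 3" "v \<noteq> a - 2" "v \<noteq> b + 2" by auto
  show ?case
  proof (cases "v - a \<le> b - v")
    case True
    then show ?thesis using both(1) bounds assms(3) by (intro answerable_both_left) auto
  next
    case False
    have "answerable (- hi) (- lo) (insert (- b - 2) (insert (- a + 2) {- b..- a}) - {- v - 1, - v + 1})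
      ({- v, - b - 2, - a + 2} \<inter> (insert (- b - 2) (insert (- a + 2) {- b..- a}) - {- v - 1, - v + 1}))
      (weight (- a - - b + 3))"
      using both(1) False bounds assms(3) by (intro answerable_both_left) auto
    then show ?thesis
      by - (rule answerable_uminus, simp add: uminus_image_Diff_Int insert_commute)
  qed
qed

text \<open>Except in very short components, some move next to an end dominates two vertices and
  leaves a single component; then \<open>weight_add_2\<close> gives both estimates.\<close>

lemma component_reduces:
  assumes "component C Q w" "C \<subseteq> {lo..hi}" "lo < hi"
  shows "\<exists>v\<in>{lo..hi}. \<exists>w'. reduces v C Q w' \<and> w' + 2 \<le> w \<and> (odd w \<longrightarrow> w' + 3 \<le> w)"
  using assms
proof (induction rule: component.induct)
  case (free a b)
  consider "b = a" | "b = a + 1" | "b \<ge> a + 2" using free by linarith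
  then show ?case
  proof cases
    case 1
    obtain v where "v \<in> {lo..hi}" "reduces v {a..b} {} 0"
      using reduces_singleton[of a lo hi "{a..b}" "{}"] 1 free by auto
    with 1 show ?thesis
      by (intro bexI[of _ v] exI[of _ 0]) (auto simp: free_weight_def weight_def)
  next
    case 2
    have "reduces a {a..b} {} 2"
      using position_single[of a] 2 by (intro reducesI[of "{a}" "{a}"]) auto
    with 2 free show ?thesis
      by (intro bexI[of _ a] exI[of _ 2]) (auto simp: free_weight_def weight_def)
  next
    case 3
    have "reduces (a + 1) {a..b} {} (end_weight (b - a - 1))"
      using position_left[of "a + 3" b] 3
      by (intro reducesI[of "insert (a + 1) {a + 3..b}" "{a + 1}"]) (auto simp: algebra_simps)
    moreover have "end_weight (b - a - 1) + 2 \<le> free_weight (b - a + 1)"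
      "odd (free_weight (b - a + 1)) \<longrightarrow> end_weight (b - a - 1) + 3 \<le> free_weight (b - a + 1)"
      using 3 weight_add_2[of "b - a - 1"] end_weight_le[of "b - a - 1"]
      by (auto simp: free_weight_def end_weight_def algebra_simps)
    ultimately show ?thesis
      using 3 free by (intro bexI[of _ "a + 1"] exI[of _ "end_weight (b - a - 1)"]) auto
  qed
next
  case (single a)
  then show ?case
    using reduces_singleton[of a lo hi "{a}" "{a}"] by auto
next
  case (left a b)
  have "reduces (a - 1) (insert (a - 2) {a..b}) {a - 2} (free_weight (b - a))"
    using position_free[of "a + 1" b] left
    by (intro reducesI[of "{a + 1..b}" "{}"]) (auto simp: algebra_simps)
  moreover have "free_weight (b - a) + 2 \<le> weight (b - a + 2)"
    "odd (weight (b - a + 2)) \<longrightarrow> free_weight (b - a) + 3 \<le> weight (b - a + 2)"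
    using left(1) weight_add_2[of "b - a"] free_weight_le[of "b - a"] by auto
  ultimately show ?case
    using left by (intro bexI[of _ "a - 1"] exI[of _ "free_weight (b - a)"]) auto
next
  case (right a b)
  have "reduces (b + 1) (insert (b + 2) {a..b}) {b + 2} (free_weight (b - a))"
    using position_free[of a "b - 1"] right
    by (intro reducesI[of "{a..b - 1}" "{}"]) (auto simp: algebra_simps)
  moreover have "free_weight (b - a) + 2 \<le> weight (b - a + 2)"
    "odd (weight (b - a + 2)) \<longrightarrow> free_weight (b - a) + 3 \<le> weight (b - a + 2)"
    using right(1) weight_add_2[of "b - a"] free_weight_le[of "b - a"] by auto
  ultimately show ?case
    using right by (intro bexI[of _ "b + 1"] exI[of _ "free_weight (b - a)"]) auto
next
  case (both a b)
  have "reduces (a - 1) (insert (a - 2) (insert (b + 2) {a..b})) {a - 2, b + 2} (end_weight (b - a + 1))"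
    using position_right[of "a + 1" b] both
    by (intro reducesI[of "insert (b + 2) {a + 1..b}" "{b + 2}"]) (auto simp: algebra_simps)
  moreover have "end_weight (b - a + 1) + 2 \<le> weight (b - a + 3)"
    "odd (weight (b - a + 3)) \<longrightarrow> end_weight (b - a + 1) + 3 \<le> weight (b - a + 3)"
    using weight_add_2[of "b - a + 1"] end_weight_le[of "b - a + 1"] by (auto simp: algebra_simps)
  ultimately show ?case
    using both by (intro bexI[of _ "a - 1"] exI[of _ "end_weight (b - a + 1)"]) auto
qed

lemma position_reduces:
  assumes "position U P w" "U \<subseteq> {lo..hi}" "lo < hi" "U \<noteq> {}"
  shows "\<exists>v\<in>{lo..hi}. \<exists>w'. reduces v U P w' \<and> w' + 2 \<le> w \<and> (odd w \<longrightarrow> w' + 3 \<le> w)"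
proof -
  obtain C Q u V R u' where *: "component C Q u" "position V R u'" "separated C V" "odd w \<Longrightarrow> odd u"
    "U = C \<union> V" "P = Q \<union> R" "w = u + u'"
  proof (cases "odd w")
    case True
    then show thesis using position_odd_component[OF assms(1)] that by metis
  next
    case False
    from assms(4) obtain x where "x \<in> U" by blast
    then show thesis using position_decompose[OF assms(1), of x] that False by metis
  qed
  then have "C \<subseteq> {lo..hi}" using assms(2) by simp
  then obtain v w' where v: "v \<in> {lo..hi}" "reduces v C Q w'" "w' + 2 \<le> u" "odd u \<longrightarrow> w' + 3 \<le> u"
    using component_reduces[OF *(1) _ assms(3)] by blast
  then have "reduces v U P (w' + u')"
    using * reduces_Un[OF v(2) component_played_subset[OF *(1)]] by simp
  with v * show ?thesis by (intro bexI[of _ v] exI[of _ "w' + u'"]) auto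
qed

lemma Staller_move_answer:
  assumes "position U P w" "U \<subseteq> {lo..hi}" "lo < hi" "x \<in> U" "\<bar>x - v\<bar> \<le> 1" "v \<notin> P"
    and "U - {v - 1, v + 1} \<noteq> {}"
  shows "\<exists>v'\<in>{lo..hi}. \<exists>w'. reduces v' (U - {v - 1, v + 1}) (insert v P \<inter> (U - {v - 1, v + 1})) w' \<and>
    (w' + 4 \<le> w \<or> odd w \<and> w' + 3 \<le> w)"
proof -
  obtain C Q u V R u' where *: "component C Q u" "position V R u'" "separated C V" "x \<in> C"
    "U = C \<union> V" "P = Q \<union> R" "w = u + u'"
    using position_decompose[OF assms(1,4)] by metis
  let ?C = "C - {v - 1, v + 1}"
  let ?Q = "insert v Q \<inter> ?C"
  have far: "\<bar>y - v\<bar> \<ge> 2" if "y \<in> V" for y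
    using *(3,4) assms(5) that unfolding separated_def by (smt (verit))
  have "R \<subseteq> V" using *(2) by (rule position_played_subset)
  moreover have "C \<inter> V = {}"
    using *(3) by (force simp: separated_def)
  moreover have "v \<notin> V" "V - {v - 1, v + 1} = V"
    using far[of v] far[of "v - 1"] far[of "v + 1"] by auto
  ultimately have U: "U - {v - 1, v + 1} = ?C \<union> V" and P: "insert v P \<inter> (?C \<union> V) = ?Q \<union> R"
    using component_played_subset[OF *(1)] unfolding * by auto
  have sep: "separated ?C V" using *(3) by (rule separated_mono) auto
  have sub: "?C \<union> V \<subseteq> {lo..hi}" using assms(2) * by auto
  have "answerable lo hi ?C ?Q u"
    using * assms by (intro answerable_component[of C Q u lo hi x]) auto
  then consider (drop) w' where "position ?C ?Q w'" "w' + 2 \<le> u" | (odd) "odd u" "position ?C ?Q (u - 1)"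
    | (reply) v' w' where "v' \<in> {lo..hi}" "reduces v' ?C ?Q w'" "w' + 4 \<le> u"
    unfolding answerable_def by blast
  then show ?thesis
    unfolding U P
  proof cases
    case drop
    have "position (?C \<union> V) (?Q \<union> R) (w' + u')"
      using drop(1) *(2) sep by (rule position_Un)
    then obtain v' w'' where "v' \<in> {lo..hi}" "reduces v' (?C \<union> V) (?Q \<union> R) w''" "w'' + 2 \<le> w' + u'"
      using position_reduces[OF _ sub assms(3)] assms(7) unfolding U by blast
    then show "\<exists>v'\<in>{lo..hi}. \<exists>w'. reduces v' (?C \<union> V) (?Q \<union> R) w' \<and> (w' + 4 \<le> w \<or> odd w \<and> w' + 3 \<le> w)"
      using drop(2) * by (intro bexI[of _ v'] exI[of _ w'']) auto
  next
    \<comment> \<open>If \<open>w\<close> is even, the total \<open>w - 1\<close> is odd and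
      Dominator gains 3, which makes 4 together. If \<open>w\<close> is odd, a gain of 2 makes 3,
      enough in that case.\<close>
    case odd
    have "position (?C \<union> V) (?Q \<union> R) (u - 1 + u')"
      using odd(2) *(2) sep by (rule position_Un)
    then obtain v' w'' where "v' \<in> {lo..hi}" "reduces v' (?C \<union> V) (?Q \<union> R) w''" "w'' + 2 \<le> u - 1 + u'"
      "odd (u - 1 + u') \<longrightarrow> w'' + 3 \<le> u - 1 + u'"
      using position_reduces[OF _ sub assms(3)] assms(7) unfolding U by blast
    then show "\<exists>v'\<in>{lo..hi}. \<exists>w'. reduces v' (?C \<union> V) (?Q \<union> R) w' \<and> (w' + 4 \<le> w \<or> odd w \<and> w' + 3 \<le> w)"
      using odd(1) * by (intro bexI[of _ v'] exI[of _ w'']) auto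
  next
    case reply
    have "reduces v' (?C \<union> V) (?Q \<union> R) (w' + u')"
      using reply(2) *(2) sep by (intro reduces_Un) auto
    then show "\<exists>v'\<in>{lo..hi}. \<exists>w'. reduces v' (?C \<union> V) (?Q \<union> R) w' \<and> (w' + 4 \<le> w \<or> odd w \<and> w' + 3 \<le> w)"
      using reply(1,3) * by (intro bexI[of _ v'] exI[of _ "w' + u'"]) auto
  qed
qed

text \<open>Each induction step is a full round, Staller's move and Dominator's answer; the weight
  after Staller's move alone need not be defined.\<close>

lemma upper_bound:
  assumes "n \<ge> 2" "S \<subseteq> {1..n}" "position (undominated n S) (int ` S \<inter> undominated n S) w"
  shows "2 * int (remaining_moves (path_graph n) Staller S) \<le> w + 1"
  using assms(2,3)
proof (induction "nat w" arbitrary: S w rule: less_induct)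
  case less
  let ?U = "undominated n S" and ?G = "path_graph n"
  let ?P = "int ` S \<inter> ?U"
  have w: "w \<ge> 0" using less.prems(2) by (rule position_weight_ge)
  have Dominator: "2 * int (remaining_moves ?G Dominator (insert v S)) + 1 \<le> w"
    if v: "v \<in> legal_moves ?G S" for v
  proof -
    let ?S = "insert v S"
    have v': "v \<in> {1..n}" "v \<notin> S" and "{int v - 1, int v, int v + 1} \<inter> ?U \<noteq> {}"
      using v legal_moves_path_graph[OF less.prems(1)] by auto
    then obtain x where x: "x \<in> ?U" "\<bar>x - int v\<bar> \<le> 1" by fastforce
    have sub: "?S \<subseteq> {1..n}" using v' less.prems by simp
    show ?thesis
    proof (cases "undominated n ?S = {}")
      case True
      moreover have "w \<noteq> 0" using position_weight_eq_0 less.prems(2) x(1) by blast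
      ultimately show ?thesis
        using legal_moves_path_graph_empty_iff[OF sub assms(1)] w by (simp add: remaining_moves_eq_0)
    next
      case False
      have "int v \<notin> ?P" using v' by auto
      have n: "1 < int n" using assms(1) by simp
      have nonempty: "?U - {int v - 1, int v + 1} \<noteq> {}" using False unfolding undominated_insert .
      obtain y w' where y: "y \<in> {1..int n}" and
        red: "reduces y (?U - {int v - 1, int v + 1}) (insert (int v) ?P \<inter> (?U - {int v - 1, int v + 1})) w'"
        and w': "w' + 4 \<le> w \<or> odd w \<and> w' + 3 \<le> w"
        using Staller_move_answer[OF less.prems(2) undominated_subset n x \<open>int v \<notin> ?P\<close> nonempty] by blast
      define z where "z = nat y"
      then have z: "y = int z" using y by simp
      have legal: "z \<in> legal_moves ?G ?S"
        using red legal_moves_path_graph_dominating[OF sub y]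
        by (simp add: reduces_def gain_move_def undominated_insert z)
      have "undominated n (insert z ?S) = ?U - {int v - 1, int v + 1} - {y - 1, y + 1}"
        by (simp add: undominated_insert z)
      moreover have "int ` insert z ?S \<inter> undominated n (insert z ?S) =
          insert y (insert (int v) ?P \<inter> (?U - {int v - 1, int v + 1})) \<inter> (?U - {int v - 1, int v + 1} - {y - 1, y + 1})"
        unfolding calculation by (auto simp: z)
      ultimately have pos: "position (undominated n (insert z ?S))
          (int ` insert z ?S \<inter> undominated n (insert z ?S)) w'"
        using red by (simp add: reduces_def)
      have "w' \<ge> 0" using pos by (rule position_weight_ge)
      have "nat w' < nat w" using w' \<open>w' \<ge> 0\<close> by linarith
      moreover have "insert z ?S \<subseteq> {1..n}" using sub y by (auto simp: z)
      ultimately have "2 * int (remaining_moves ?G Staller (insert z ?S)) \<le> w' + 1"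
        using less.hyps pos by blast
      moreover have "remaining_moves ?G Dominator ?S \<le> Suc (remaining_moves ?G Staller (insert z ?S))"
        by (rule remaining_moves_Dominator_le[OF finite_pverts_path_graph legal order_refl])
      \<comment> \<open>If only \<open>w' + 3 \<le> w\<close> is known, then \<open>w\<close> is odd
        and the even number \<open>2 * d\<close>, being at most \<open>w' + 3\<close>, lies strictly
        below \<open>w\<close>.\<close>
      moreover have "2 * int d + 1 \<le> w" if "2 * int r \<le> w' + 1" "d \<le> Suc r" for d r
        using that w' by presburger
      ultimately show ?thesis by blast
    qed
  qed
  show ?case
  proof (cases "w = 0")
    case True
    then have "?U = {}" using position_weight_eq_0 less.prems(2) by blast
    then show ?thesis
      using legal_moves_path_graph_empty_iff[OF less.prems(1) assms(1)] True
      by (simp add: remaining_moves_eq_0)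
  next
    case False
    have "d \<le> nat ((w - 1) div 2)" if "2 * int d + 1 \<le> w" for d
      using that by linarith
    then have "remaining_moves ?G Staller S \<le> Suc (nat ((w - 1) div 2))"
      using Dominator by (intro remaining_moves_Staller_le finite_pverts_path_graph) blast
    moreover have "2 * int r \<le> w + 1" if "r \<le> Suc (nat ((w - 1) div 2))" for r
      using that w False by linarith
    ultimately show ?thesis by blast
  qed
qed

lemma L_game_number_path_graph_1: "\<gamma>\<^sub>L\<^sub>g (path_graph 1) = 1"
proof -
  have "legal_moves (path_graph 1) {} = {1}"
    using legal_moves_path_graph[of "{}" 1] by (auto simp: undominated_empty)
  moreover have "legal_moves (path_graph 1) {1} = {}"
    using legal_moves_path_graph_subset[of 1 "{1}"] by simp
  ultimately show ?thesis
    unfolding L_game_number_def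
    by (subst remaining_moves.simps) (simp add: finite_pverts_path_graph remaining_moves_eq_0)
qed

text \<open>Dominator opens with \<open>2\<close>: this dominates both \<open>1\<close> and
  \<open>3\<close> (if present) and leaves one component whose left end \<open>2\<close> is
  selected.\<close>

lemma L_game_number_path_graph_le:
  assumes "n \<ge> 2"
  shows "3 * \<gamma>\<^sub>L\<^sub>g (path_graph n) \<le> 2 * n + 3"
proof -
  let ?R = "remaining_moves (path_graph n) Staller {2}"
  have U: "undominated n {2} = {1..int n} - {1, 3}"
    using undominated_insert[of n 2 "{}"] by (simp add: undominated_empty)
  \<comment> \<open>The maximum is for \<open>n = 2\<close>, where \<open>3\<close> is not on the
    path and one vertex remains instead of \<open>n - 2\<close>.\<close>
  have "position (undominated n {2}) (int ` {2} \<inter> undominated n {2}) (end_weight (max 1 (int n - 2)))"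
  proof (cases "n = 2")
    case True
    have "{1..2} - {1, 3} = {2::int}" by auto
    with True have "undominated n {2} = {2}" unfolding U by simp
    then show ?thesis using position_single[of 2] True by (simp add: end_weight_def)
  next
    case False
    then have "3 \<le> int n" using assms by simp
    then have "undominated n {2} = insert 2 {4..int n}" unfolding U by auto
    then show ?thesis using position_left[of 4 "int n"] False assms by simp
  qed
  then have "2 * int ?R \<le> end_weight (max 1 (int n - 2)) + 1"
    using assms by (intro upper_bound) auto
  moreover have "3 * Suc r \<le> 2 * n + 3" if "2 * int r \<le> end_weight (max 1 (int n - 2)) + 1" for r
    using that assms by (simp add: end_weight_def weight_def max_def split: if_splits) presburger+
  ultimately have "3 * Suc ?R \<le> 2 * n + 3"
    by blast
  moreover have "remaining_moves (path_graph n) Dominator {} \<le> Suc ?R"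
  proof (rule remaining_moves_Dominator_le[OF finite_pverts_path_graph])
    have "1 \<in> undominated n {}" using assms by (simp add: undominated_empty)
    then show "2 \<in> legal_moves (path_graph n) {}"
      using legal_moves_path_graph[of "{}" n 2] assms by auto
  qed simp
  ultimately show ?thesis
    unfolding L_game_number_def by (meson order_trans mult_le_mono2)
qed

text \<open>The 3 consists of 2 for the two undominated ends at the start and 1 for Dominator's
  turn.\<close>

lemma L_game_number_path_graph_ge:
  assumes "n \<ge> 2"
  shows "2 * n \<le> 3 * \<gamma>\<^sub>L\<^sub>g (path_graph n) + 3"
  using lower_bound[OF assms, of "{}" Dominator] assms
  by (simp add: L_game_number_def undominated_empty both_ends_def)

theorem theorem5p4:
  fixes n :: nat
  assumes "n \<ge> 1"
  shows "\<exists>c::real. \<bar>c\<bar> \<le> 1 \<and> real (\<gamma>\<^sub>L\<^sub>g (path_graph n)) = 2 * real n / 3 + c"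
proof -
  have "2 * n \<le> 3 * \<gamma>\<^sub>L\<^sub>g (path_graph n) + 3 \<and> 3 * \<gamma>\<^sub>L\<^sub>g (path_graph n) \<le> 2 * n + 3"
  proof (cases "n = 1")
    case False
    then show ?thesis
      using assms L_game_number_path_graph_ge[of n] L_game_number_path_graph_le[of n] by simp
  qed (use L_game_number_path_graph_1 in simp)
  then have "\<bar>real (\<gamma>\<^sub>L\<^sub>g (path_graph n)) - 2 * real n / 3\<bar> \<le> 1"
    by linarith
  then show ?thesis
    by (intro exI[of _ "real (\<gamma>\<^sub>L\<^sub>g (path_graph n)) - 2 * real n / 3"]) simp
qed

end
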